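(* Let $q$ be a prime power, let $n,k$ be positive integers with $n\geq 2k+1$, let $t\in\{0,1,\dots,k-1\}$ and $S=\{0,1,\dots,t\}$. Then \[Z(J_{q,S}(n,k))\geq\binom{n}{k}_q-\binom{2k-2t}{k-t}.\]
   Context: For a prime power $q$, $\mathbb{F}_q$ is the finite field of order $q$. For $S\subseteq\{0,1,\dots,k-1\}$, the generalized Grassmann graph $J_{q,S}(n,k)$ is the simple graph whose vertices are the $k$-dimensional subspaces of $\mathbb{F}_q^n$, two distinct vertices being adjacent if and only if the dimension of their intersection lies in $S$. $\binom{n}{k}_q=\prod_{i=0}^{k-1}\frac{1-q^{n-i}}{1-q^{i+1}}$ is the Gaussian binomial coefficient (the number of vertices). Zero forcing on a graph $G$: start with a set of black vertices, all others white; repeatedly, if a black vertex $v$ has exactly one white neighbor $w$, color $w$ black. A zero forcing set is an initial black set for which this eventually colors all vertices black; $Z(G)$ is the minimum size of a zero forcing set. *)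

theory Defs
  imports "HOL-Analysis.Analysis" "HOL-Number_Theory.Prime_Powers" "Graph_Theory.Pair_Digraph"
begin

text \<open>
  The field of order \<open>q\<close> is a type \<open>'a\<close> of classes \<open>field\<close> and \<open>finite\<close> with \<open>CARD('a) = q\<close>, and
  its \<open>n\<close>-dimensional coordinate space is \<open>'a ^ 'n\<close> with \<open>CARD('n) = n\<close>.  Finite simple graphs are
  represented by the locale \<open>pair_graph\<close>, where an edge is a symmetric pair of arcs.
\<close>

definition gen_grassmann_graph ::
    "nat set \<Rightarrow> nat \<Rightarrow> ('a :: {field, finite} ^ 'n) set pair_pre_digraph" where
  "gen_grassmann_graph S k =
    \<lparr> pverts = {U. vec.subspace U \<and> vec.dim U = k},
      parcs = {(U, W). vec.subspace U \<and> vec.dim U = k \<and> vec.subspace W \<and> vec.dim W = k \<and>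
                       U \<noteq> W \<and> vec.dim (U \<inter> W) \<in> S} \<rparr>"

lemma pair_graph_gen_grassmann_graph:
  "pair_graph (gen_grassmann_graph S k :: ('a :: {field, finite} ^ 'n) set pair_pre_digraph)"
proof -
  let ?G = "gen_grassmann_graph S k :: ('a ^ 'n) set pair_pre_digraph"
  have "pair_wf_digraph ?G"
    by (rule pair_wf_digraph.intro) (auto simp: gen_grassmann_graph_def)
  moreover have "sym (parcs ?G)"
    by (rule symI) (auto simp: gen_grassmann_graph_def Int_commute)
  ultimately show ?thesis
    by (simp add: pair_graph_def pair_digraph_def pair_pseudo_graph_def pair_fin_digraph_def
        pair_sym_digraph_def pair_loopfree_digraph_def pair_fin_digraph_axioms_def
        pair_sym_digraph_axioms_def pair_loopfree_digraph_axioms_def symmetric_def)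
      (auto simp: gen_grassmann_graph_def)
qed

definition gaussian_binomial :: "nat \<Rightarrow> nat \<Rightarrow> nat \<Rightarrow> real" where
  "gaussian_binomial q n k =
    (\<Prod>i<k. (1 - real q ^ (n - i)) / (1 - real q ^ (i + 1)))"

definition neighbours :: "'v pair_pre_digraph \<Rightarrow> 'v \<Rightarrow> 'v set" where
  "neighbours G v = {w. (v, w) \<in> parcs G}"

text \<open>\<open>force_step G B B'\<close>: from the set \<open>B\<close> of black vertices, a single force leads to \<open>B'\<close>.\<close>

inductive force_step :: "'v pair_pre_digraph \<Rightarrow> 'v set \<Rightarrow> 'v set \<Rightarrow> bool" for G where
  "v \<in> B \<Longrightarrow> neighbours G v - B = {w} \<Longrightarrow> force_step G B (insert w B)"

definition zero_forcing_set :: "'v pair_pre_digraph \<Rightarrow> 'v set \<Rightarrow> bool" where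
  "zero_forcing_set G B \<longleftrightarrow> B \<subseteq> pverts G \<and> (force_step G)\<^sup>*\<^sup>* B (pverts G)"

definition zero_forcing_number :: "'v pair_pre_digraph \<Rightarrow> nat" where
  "zero_forcing_number G = Min (card ` {B. zero_forcing_set G B})"

text \<open>On a finite vertex set, the minimum is taken over a finite nonempty set.\<close>

lemma zero_forcing_set_pverts: "zero_forcing_set G (pverts G)"
  by (simp add: zero_forcing_set_def)

lemma finite_zero_forcing_sets: "finite (pverts G) \<Longrightarrow> finite {B. zero_forcing_set G B}"
  by (rule finite_subset[of _ "Pow (pverts G)"]) (auto simp: zero_forcing_set_def)

end

theory Submission
  imports Defs "Jordan_Normal_Form.Determinant"
    "HOL-Computational_Algebra.Formal_Laurent_Series"
begin

text \<open>
  If \<open>v\<^sub>i\<close> forces \<open>w\<^sub>i\<close> at step \<open>i\<close>, then \<open>v\<^sub>i\<close> and \<open>w\<^sub>i\<close> meet in dimension at most \<open>t\<close>, while \<open>v\<^sub>i\<close> and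
  the still white \<open>w\<^sub>j\<close> with \<open>j > i\<close> meet in dimension greater than \<open>t\<close>. The number of forces is thus
  bounded by the skew Bollobas theorem for subspaces: intersecting with a generic subspace of
  codimension \<open>t\<close> and projecting generically to dimension \<open>2 (k - t)\<close>, one gets a matrix of
  determinants that is triangular with nonzero diagonal and that by Laplace expansion has rank at
  most \<open>2 (k - t)\<close> choose \<open>k - t\<close>. Both generic choices are encoded in one \<open>2 k \<times> 2 k\<close> determinant.
\<close>

section \<open>Counting subspaces\<close>

text \<open>Over a finite field a nonzero polynomial may vanish at every point, so one choice that
  is generic for all pairs need not exist there. It is made over the infinite field of Laurent
  series. The subspaces themselves are not extended: only the functionals take values in the larger
  field, and all dimension conditions become conditions on determinants whose entries are
  functionals applied to fixed bases. Such a determinant is a polynomial along any line of systems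
  of functionals, so one system serves all pairs as soon as each pair has a system of its own, and
  that one is found over the small field. Cutting with the kernel first would require bases that
  depend on the functionals. The block form keeps the original bases: with e = k - t its columns
  fall into blocks of sizes 2e, t and t, where each subspace has its own copy of the t equations.
  The zero blocks force a column set that contributes to the Laplace expansion to contain the middle
  block and avoid the last one, which leaves e columns to be chosen among 2e.\<close>

lemma card_span_insert:
  fixes x :: "'a :: {field, finite} ^ 'n"
  assumes "x \<notin> vec.span S"
  shows "card (vec.span (insert x S)) = CARD('a) * card (vec.span S)"
proof -
  have "bij_betw (\<lambda>(c, v). c *s x + v) (UNIV \<times> vec.span S) (vec.span (insert x S))"
  proof (rule bij_betw_imageI)
    show "inj_on (\<lambda>(c, v). c *s x + v) (UNIV \<times> vec.span S)"
    proof (rule inj_onI, clarify)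
      fix c v c' v'
      assume v: "v \<in> vec.span S" "v' \<in> vec.span S" and eq: "c *s x + v = c' *s x + v'"
      have "(c - c') *s x = v' - v"
        using eq by (simp add: vec.scale_left_diff_distrib algebra_simps)
      then have "(c - c') *s x \<in> vec.span S"
        using v by (simp add: vec.span_diff)
      then have "c = c'"
        using assms vec.span_scale[of "(c - c') *s x" S "inverse (c - c')"]
        by (cases "c = c'") (simp_all del: vec.scale_left_diff_distrib vector_sub_rdistrib)
      then show "c = c' \<and> v = v'" using eq by simp
    qed
    show "(\<lambda>(c, v). c *s x + v) ` (UNIV \<times> vec.span S) = vec.span (insert x S)"
    proof (intro equalityI subsetI)
      fix y assume "y \<in> vec.span (insert x S)"
      then obtain c where "y - c *s x \<in> vec.span S"
        by (auto simp: vec.span_insert)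
      then show "y \<in> (\<lambda>(c, v). c *s x + v) ` (UNIV \<times> vec.span S)"
        by (intro image_eqI[of _ _ "(c, y - c *s x)"]) auto
    next
      fix y assume "y \<in> (\<lambda>(c, v). c *s x + v) ` (UNIV \<times> vec.span S)"
      then obtain c v where "v \<in> vec.span S" "y = c *s x + v" by auto
      then show "y \<in> vec.span (insert x S)"
        unfolding vec.span_insert by (auto intro!: exI[of _ c])
    qed
  qed
  from bij_betw_same_card[OF this] show ?thesis by (simp add: card_cartesian_product)
qed

lemma card_span_independent:
  fixes S :: "('a :: {field, finite} ^ 'n) set"
  assumes "vec.independent S"
  shows "card (vec.span S) = CARD('a) ^ card S"
proof -
  have "finite S" by simp
  then show ?thesis using assms
    by (induction S rule: finite_induct) (auto simp: vec.independent_insert card_span_insert)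
qed

lemma card_subspace:
  fixes U :: "('a :: {field, finite} ^ 'n) set"
  assumes "vec.subspace U"
  shows "card U = CARD('a) ^ vec.dim U"
proof -
  obtain B where B: "B \<subseteq> U" "vec.independent B" "U \<subseteq> vec.span B" "card B = vec.dim U"
    by (rule vec.basis_exists)
  then have "vec.span B = U"
    using assms by (simp add: subset_antisym vec.span_minimal)
  then show ?thesis using B card_span_independent by metis
qed

text \<open>Lists instead of sets, so that bases are ordered and can be counted by adding one vector
  at a time.\<close>

definition independent_lists :: "('a :: field ^ 'n) set \<Rightarrow> nat \<Rightarrow> ('a ^ 'n) list set" where
  "independent_lists U j =
    {xs. length xs = j \<and> distinct xs \<and> set xs \<subseteq> U \<and> vec.independent (set xs)}"

lemma finite_independent_lists:
  "finite (independent_lists (U :: ('a :: {field, finite} ^ 'n) set) j)"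
  by (rule finite_subset[OF _ finite_lists_length_eq[of UNIV j]])
    (auto simp: independent_lists_def)

text \<open>A list of length \<open>j\<close> is extended by any vector of \<open>U\<close> outside
  its span, which has \<open>CARD('a) ^ j\<close> elements. Truncated subtraction does no harm: for
  \<open>j\<close> beyond the dimension, the factor at \<open>i = vec.dim U\<close> is already
  0.\<close>

lemma card_independent_lists:
  fixes U :: "('a :: {field, finite} ^ 'n) set"
  assumes U: "vec.subspace U"
  shows "card (independent_lists U j) = (\<Prod>i<j. CARD('a) ^ vec.dim U - CARD('a) ^ i)"
proof (induction j)
  case 0
  have "independent_lists U 0 = {[]}"
    by (auto simp: independent_lists_def vec.independent_empty)
  then show ?case by simp
next
  case (Suc j)
  let ?P = "SIGMA xs : independent_lists U j. U - vec.span (set xs)"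
  have "bij_betw (\<lambda>(xs, x). x # xs) ?P (independent_lists U (Suc j))"
  proof (rule bij_betw_imageI)
    show "inj_on (\<lambda>(xs, x). x # xs) ?P" by (auto simp: inj_on_def)
    show "(\<lambda>(xs, x). x # xs) ` ?P = independent_lists U (Suc j)"
    proof (intro equalityI subsetI)
      fix ys assume "ys \<in> independent_lists U (Suc j)"
      then obtain x xs where "ys = x # xs" "xs \<in> independent_lists U j" "x \<in> U - vec.span (set xs)"
        by (cases ys) (auto simp: independent_lists_def vec.independent_insert)
      then show "ys \<in> (\<lambda>(xs, x). x # xs) ` ?P" by (auto intro!: image_eqI[of _ _ "(xs, x)"])
    qed (auto simp: independent_lists_def vec.independent_insertI dest: vec.span_base)
  qed
  from bij_betw_same_card[OF this]
  have "card (independent_lists U (Suc j)) =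
      (\<Sum>xs \<in> independent_lists U j. card (U - vec.span (set xs)))"
    by (simp add: finite_independent_lists)
  also have "\<dots> = (\<Sum>xs \<in> independent_lists U j. CARD('a) ^ vec.dim U - CARD('a) ^ j)"
  proof (rule sum.cong[OF refl])
    fix xs assume xs: "xs \<in> independent_lists U j"
    then have "vec.span (set xs) \<subseteq> U"
      using U by (simp add: independent_lists_def vec.span_minimal)
    then show "card (U - vec.span (set xs)) = CARD('a) ^ vec.dim U - CARD('a) ^ j"
      using xs card_subspace[OF U] card_span_independent[of "set xs"]
      by (simp add: card_Diff_subset independent_lists_def distinct_card)
  qed
  finally show ?case using Suc.IH by simp
qed

text \<open>Double counting of ordered independent \<open>k\<close>-tuples: each spans exactly one
  \<open>k\<close>-dimensional subspace, and all these subspaces contain equally many. The product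
  form avoids division in \<open>nat\<close>.\<close>

lemma card_subspaces_of_dim_mult:
  "card {U :: ('a :: {field, finite} ^ 'n) set. vec.subspace U \<and> vec.dim U = k} *
    (\<Prod>i<k. CARD('a) ^ k - CARD('a) ^ i) = (\<Prod>i<k. CARD('a) ^ CARD('n) - CARD('a) ^ i)"
proof -
  let ?V = "{U :: ('a ^ 'n) set. vec.subspace U \<and> vec.dim U = k}"
  have span_eq: "vec.span (set xs) = U" if "U \<in> ?V" "xs \<in> independent_lists U k" for U xs
  proof -
    have "vec.dim (vec.span (set xs)) = vec.dim U"
      using that by (simp add: independent_lists_def vec.dim_eq_card_independent distinct_card)
    moreover have "vec.span (set xs) \<subseteq> U"
      using that by (simp add: independent_lists_def vec.span_minimal)
    ultimately show ?thesis
      using that by (intro vec.subspace_dim_equal) auto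
  qed
  have "independent_lists UNIV k = (\<Union>U \<in> ?V. independent_lists U k)"
  proof (intro equalityI subsetI)
    fix xs :: "('a ^ 'n) list" assume "xs \<in> independent_lists UNIV k"
    then have "vec.span (set xs) \<in> ?V" "xs \<in> independent_lists (vec.span (set xs)) k"
      by (auto simp: independent_lists_def vec.dim_eq_card_independent distinct_card
          vec.span_base)
    then show "xs \<in> (\<Union>U \<in> ?V. independent_lists U k)" by blast
  qed (auto simp: independent_lists_def)
  also have "card \<dots> = (\<Sum>U \<in> ?V. card (independent_lists U k))"
  proof (rule card_UN_disjoint)
    show "\<forall>U \<in> ?V. \<forall>W \<in> ?V. U \<noteq> W \<longrightarrow> independent_lists U k \<inter> independent_lists W k = {}"
      using span_eq by (metis (no_types, lifting) disjoint_iff)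
  qed (simp_all add: finite_independent_lists)
  also have "\<dots> = (\<Sum>U \<in> ?V. \<Prod>i<k. CARD('a) ^ k - CARD('a) ^ i)"
    by (intro sum.cong) (auto simp: card_independent_lists)
  finally show ?thesis
    by (simp add: card_independent_lists vec.dim_UNIV card_cart_basis)
qed

text \<open>For m = n and for m = k alike, q^m - q^i = -q^i (1 - q^(m-i)), so the factors -q^i
  cancel.\<close>

lemma gaussian_binomial_mult:
  assumes "1 < q" and "k \<le> n"
  shows "gaussian_binomial q n k * (\<Prod>i<k. real q ^ k - real q ^ i) =
    (\<Prod>i<k. real q ^ n - real q ^ i)"
proof -
  have factor: "(\<Prod>i<k. real q ^ m - real q ^ i) = (\<Prod>i<k. - (real q ^ i)) * (\<Prod>i<k. 1 - real q ^ (m - i))"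
    if "k \<le> m" for m
    unfolding prod.distrib[symmetric] using that
    by (intro prod.cong) (auto simp: algebra_simps power_add[symmetric])
  \<comment> \<open>The exponents run downwards here and upwards in
    \<open>gaussian_binomial\<close>.\<close>
  have "(\<Prod>i<k. 1 - real q ^ (k - i)) = (\<Prod>i<k. 1 - real q ^ (i + 1))"
    by (rule prod.reindex_bij_witness[of _ "\<lambda>i. k - 1 - i" "\<lambda>i. k - 1 - i"])
      (auto simp: Suc_diff_Suc simp del: power_Suc)
  moreover have "(\<Prod>i<k. 1 - real q ^ (i + 1)) \<noteq> 0"
  proof -
    have "1 < real q ^ (i + 1)" for i
      using assms(1) by (intro one_less_power) auto
    then show ?thesis by (simp add: less_imp_neq del: power_Suc)
  qed
  ultimately show ?thesis
    using assms(2) by (simp add: gaussian_binomial_def prod_dividef factor)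
qed

lemma card_subspaces_of_dim:
  assumes "k \<le> CARD('n)"
  shows "real (card {U :: ('a :: {field, finite} ^ 'n) set. vec.subspace U \<and> vec.dim U = k}) =
    gaussian_binomial CARD('a) CARD('n) k"
proof -
  have "card {0, 1 :: 'a} \<le> CARD('a)" by (rule card_mono) auto
  then have q: "1 < CARD('a)" by simp
  have of_nat_prod_diff: "real (\<Prod>i<k. CARD('a) ^ m - CARD('a) ^ i) = (\<Prod>i<k. real CARD('a) ^ m - real CARD('a) ^ i)"
    if "k \<le> m" for m
    unfolding of_nat_prod using that q
    by (intro prod.cong) (auto simp: of_nat_diff power_increasing)
  have "(\<Prod>i<k. real CARD('a) ^ k - real CARD('a) ^ i) \<noteq> 0"
    using q by (auto dest!: power_inject_exp[THEN iffD1, rotated])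
  moreover have "real (card {U :: ('a ^ 'n) set. vec.subspace U \<and> vec.dim U = k}) *
      (\<Prod>i<k. real CARD('a) ^ k - real CARD('a) ^ i) =
      gaussian_binomial CARD('a) CARD('n) k * (\<Prod>i<k. real CARD('a) ^ k - real CARD('a) ^ i)"
    unfolding gaussian_binomial_mult[OF q assms]
    unfolding of_nat_prod_diff[OF assms, symmetric] of_nat_prod_diff[OF order.refl, symmetric]
      of_nat_mult[symmetric] card_subspaces_of_dim_mult ..
  ultimately show ?thesis by simp
qed

section \<open>Determinants\<close>

text \<open>Dependence of rows, since the rows will belong to basis vectors. Coefficients are plain
  functions, which are easily split and glued along blocks.\<close>

lemma det_mat_eq_0_iff:
  fixes M :: "nat \<Rightarrow> nat \<Rightarrow> 'k :: field"
  shows "Determinant.det (Matrix.mat N N (\<lambda>(i, j). M i j)) = 0 \<longleftrightarrow>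
    (\<exists>w. (\<exists>i<N. w i \<noteq> 0) \<and> (\<forall>j<N. (\<Sum>i<N. w i * M i j) = 0))"
proof -
  let ?A = "Matrix.mat N N (\<lambda>(i, j). M i j)"
  have A: "?A \<in> carrier_mat N N" by simp
  have mult: "(transpose_mat ?A *\<^sub>v w = 0\<^sub>v N) \<longleftrightarrow> (\<forall>j<N. (\<Sum>i<N. vec_index w i * M i j) = 0)"
    if "w \<in> carrier_vec N" for w
    using that by (auto simp: vec_eq_iff scalar_prod_def lessThan_atLeast0 mult.commute
        intro!: sum.cong)
  have "Determinant.det ?A = Determinant.det (transpose_mat ?A)"
    using det_transpose[OF A] by simp
  also have "\<dots> = 0 \<longleftrightarrow> (\<exists>w. w \<in> carrier_vec N \<and> w \<noteq> 0\<^sub>v N \<and> transpose_mat ?A *\<^sub>v w = 0\<^sub>v N)"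
    by (rule det_0_iff_vec_prod_zero_field) simp
  also have "\<dots> \<longleftrightarrow> (\<exists>w. (\<exists>i<N. w i \<noteq> 0) \<and> (\<forall>j<N. (\<Sum>i<N. w i * M i j) = 0))"
  proof
    assume "\<exists>w. w \<in> carrier_vec N \<and> w \<noteq> 0\<^sub>v N \<and> transpose_mat ?A *\<^sub>v w = 0\<^sub>v N"
    then obtain w where w: "w \<in> carrier_vec N" "w \<noteq> 0\<^sub>v N" "transpose_mat ?A *\<^sub>v w = 0\<^sub>v N"
      by blast
    then have "\<exists>i<N. vec_index w i \<noteq> 0" by (auto simp: vec_eq_iff)
    then show "\<exists>w. (\<exists>i<N. w i \<noteq> 0) \<and> (\<forall>j<N. (\<Sum>i<N. w i * M i j) = 0)"
      using w mult by (intro exI[of _ "vec_index w"]) blast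
  next
    assume "\<exists>w. (\<exists>i<N. w i \<noteq> 0) \<and> (\<forall>j<N. (\<Sum>i<N. w i * M i j) = 0)"
    then obtain w where w: "\<exists>i<N. w i \<noteq> 0" "\<forall>j<N. (\<Sum>i<N. w i * M i j) = 0"
      by blast
    then show "\<exists>w. w \<in> carrier_vec N \<and> w \<noteq> 0\<^sub>v N \<and> transpose_mat ?A *\<^sub>v w = 0\<^sub>v N"
      using mult[of "Matrix.vec N w"] by (intro exI[of _ "Matrix.vec N w"]) (auto simp: vec_eq_iff)
  qed
  finally show ?thesis .
qed

lemma homogeneous_system_nontrivial:
  fixes g :: "'i \<Rightarrow> nat \<Rightarrow> 'k :: field"
  assumes "finite I" and "card I < m"
  shows "\<exists>c. (\<exists>j<m. c j \<noteq> 0) \<and> (\<forall>r\<in>I. (\<Sum>j<m. c j * g r j) = 0)"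
proof -
  obtain e where e: "bij_betw e {0..<card I} I"
    using ex_bij_betw_nat_finite[OF assms(1)] by blast
  \<comment> \<open>Zero equations pad the system to a square one.\<close>
  define M where "M = (\<lambda>r j. if r < card I then g (e r) j else 0)"
  let ?A = "Matrix.mat m m (\<lambda>(r, j). M r j)"
  \<comment> \<open>Row \<open>card I\<close> is a padding row because \<open>card I < m\<close>, so
    the unit vector at it is a left kernel vector.\<close>
  have "\<exists>w. (\<exists>r<m. w r \<noteq> 0) \<and> (\<forall>j<m. (\<Sum>r<m. w r * M r j) = 0)"
    using assms(2)
    by (intro exI[of _ "\<lambda>r. if r = card I then 1 else 0"]) (auto simp: M_def intro!: sum.neutral)
  then have "Determinant.det ?A = 0"
    unfolding det_mat_eq_0_iff .
  moreover have "transpose_mat ?A = Matrix.mat m m (\<lambda>(j, r). M r j)"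
    by (rule eq_matI) auto
  ultimately have "Determinant.det (Matrix.mat m m (\<lambda>(j, r). M r j)) = 0"
    using det_transpose[of ?A m] by simp
  then obtain c where c: "\<exists>j<m. c j \<noteq> 0" "\<And>r. r < m \<Longrightarrow> (\<Sum>j<m. c j * M r j) = 0"
    unfolding det_mat_eq_0_iff by blast
  have "(\<Sum>j<m. c j * g r j) = 0" if "r \<in> I" for r
  proof -
    have "r \<in> e ` {0..<card I}"
      using that bij_betw_imp_surj_on[OF e] by simp
    then obtain i where "i < card I" "e i = r" by auto
    then show ?thesis using c(2)[of i] assms(2) by (simp add: M_def)
  qed
  then show ?thesis using c(1) by blast
qed

text \<open>With fewer than \<open>m\<close> terms, some nonzero \<open>c\<close> is orthogonal to
  every \<open>g r\<close>, hence to every row of \<open>D\<close>. In the row of the least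
  \<open>i\<close> with \<open>c i \<noteq> 0\<close>, triangularity leaves only
  \<open>c i * D i i\<close>, a contradiction.\<close>

lemma triangular_rank_bound:
  fixes D :: "nat \<Rightarrow> nat \<Rightarrow> 'k :: field"
  assumes "finite I"
    and "\<And>i j. i < m \<Longrightarrow> j < m \<Longrightarrow> D i j = (\<Sum>r\<in>I. f r i * g r j)"
    and "\<And>i. i < m \<Longrightarrow> D i i \<noteq> 0"
    and "\<And>i j. i < j \<Longrightarrow> j < m \<Longrightarrow> D i j = 0"
  shows "m \<le> card I"
proof (rule ccontr)
  assume "\<not> m \<le> card I"
  then obtain c where c: "\<exists>j<m. c j \<noteq> 0" "\<And>r. r \<in> I \<Longrightarrow> (\<Sum>j<m. c j * g r j) = 0"
    using homogeneous_system_nontrivial[OF assms(1), of m g] by auto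
  define i where "i = (LEAST i. i < m \<and> c i \<noteq> 0)"
  have i: "i < m" "c i \<noteq> 0"
    using LeastI_ex[of "\<lambda>i. i < m \<and> c i \<noteq> 0"] c(1) unfolding i_def by blast+
  have below: "c j = 0" if "j < i" for j
    using not_less_Least[of j "\<lambda>i. i < m \<and> c i \<noteq> 0"] that i(1) unfolding i_def by auto
  have "(\<Sum>j<m. c j * D i j) = (\<Sum>j<m. \<Sum>r\<in>I. f r i * (c j * g r j))"
    using i(1) by (intro sum.cong) (auto simp: assms(2) sum_distrib_left mult_ac)
  also have "\<dots> = (\<Sum>r\<in>I. f r i * (\<Sum>j<m. c j * g r j))"
    by (subst sum.swap) (simp add: sum_distrib_left)
  also have "\<dots> = 0" using c(2) by simp
  finally have "(\<Sum>j<m. c j * D i j) = 0" .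
  moreover have "(\<Sum>j<m. c j * D i j) = (\<Sum>j\<in>{i}. c j * D i j)"
  proof (rule sum.mono_neutral_right)
    show "\<forall>j\<in>{..<m} - {i}. c j * D i j = 0"
      using below assms(4)[of i] by (auto simp: neq_iff)
  qed (use i in auto)
  ultimately show False using i assms(3) by simp
qed

section \<open>Laplace expansion along the first k rows\<close>

definition block_permutation :: "nat \<Rightarrow> nat \<Rightarrow> nat set \<Rightarrow> nat \<Rightarrow> nat" where
  "block_permutation k l R = (SOME p. p permutes {0..<k+l} \<and> p ` {0..<k} = R)"

text \<open>Up to sign the minor of the first \<open>k\<close> rows on the columns \<open>R\<close>.
  It involves \<open>A\<close> alone, so each Laplace term is a product of a function of
  \<open>A\<close> and a function of \<open>B\<close>.\<close>

definition upper_minor :: "nat \<Rightarrow> nat \<Rightarrow> nat set \<Rightarrow> (nat \<Rightarrow> nat \<Rightarrow> 'k :: comm_ring_1) \<Rightarrow> 'k" where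
  "upper_minor k l R A = (\<Sum>\<alpha> | \<alpha> permutes {0..<k}.
    signof \<alpha> * (\<Prod>i\<in>{0..<k}. A i (block_permutation k l R (\<alpha> i))))"

text \<open>The complementary minor. The sign of the Laplace term sits here, as the sign of the
  chosen permutation.\<close>

definition lower_minor :: "nat \<Rightarrow> nat \<Rightarrow> nat set \<Rightarrow> (nat \<Rightarrow> nat \<Rightarrow> 'k :: comm_ring_1) \<Rightarrow> 'k" where
  "lower_minor k l R B = signof (block_permutation k l R) * (\<Sum>\<beta> | \<beta> permutes {k..<k+l}.
    signof \<beta> * (\<Prod>i\<in>{k..<k+l}. B i (block_permutation k l R (\<beta> i))))"

lemma block_permutation:
  assumes "R \<subseteq> {0..<k+l}" and "card R = k"
  shows "block_permutation k l R permutes {0..<k+l}"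
    and "block_permutation k l R ` {0..<k} = R"
proof -
  have fin: "finite R" using assms(1) finite_subset by blast
  obtain f where f: "bij_betw f {0..<k} R"
    using ex_bij_betw_nat_finite[OF fin] assms(2) by auto
  have "card ({0..<k+l} - R) = l"
    using assms fin by (simp add: card_Diff_subset)
  then obtain g where g: "bij_betw g {k..<k+l} ({0..<k+l} - R)"
    using finite_same_card_bij[of "{k..<k+l}" "{0..<k+l} - R"] by auto
  define p where "p = (\<lambda>i. if i < k then f i else if i < k + l then g i else i)"
  have "bij_betw p ({0..<k} \<union> {k..<k+l}) (R \<union> ({0..<k+l} - R))"
  proof (rule bij_betw_combine)
    show "bij_betw p {0..<k} R"
      using f by (rule bij_betw_cong[THEN iffD1, rotated]) (simp add: p_def)
    show "bij_betw p {k..<k+l} ({0..<k+l} - R)"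
      using g by (rule bij_betw_cong[THEN iffD1, rotated]) (simp add: p_def)
  qed auto
  moreover have "{0..<k} \<union> {k..<k+l} = {0..<k+l}" by auto
  moreover have "R \<union> ({0..<k+l} - R) = {0..<k+l}" using assms(1) by auto
  ultimately have "p permutes {0..<k+l}"
    by (intro bij_imp_permutes) (auto simp: p_def)
  moreover have "p ` {0..<k} = R"
    using f by (auto simp: p_def bij_betw_def)
  ultimately have "\<exists>p. p permutes {0..<k+l} \<and> p ` {0..<k} = R" by blast
  from someI_ex[OF this] show "block_permutation k l R permutes {0..<k+l}"
    and "block_permutation k l R ` {0..<k} = R"
    unfolding block_permutation_def by blast+
qed

text \<open>The permutations carrying \<open>{0..<k}\<close> onto \<open>R\<close> form a left coset
  of the group that preserves both blocks, and \<open>block_permutation k l R\<close> represents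
  it.\<close>

lemma bij_betw_block_permutations:
  assumes "R \<subseteq> {0..<k+l}" and "card R = k"
  shows "bij_betw (\<lambda>(\<alpha>, \<beta>). block_permutation k l R \<circ> (\<alpha> \<circ> \<beta>))
    ({\<alpha>. \<alpha> permutes {0..<k}} \<times> {\<beta>. \<beta> permutes {k..<k+l}})
    {p. p permutes {0..<k+l} \<and> p ` {0..<k} = R}"
proof (rule bij_betw_imageI)
  let ?s = "block_permutation k l R"
  note s = block_permutation[OF assms]
  have inj: "inj ?s" using s(1) by (rule permutes_inj)
  \<comment> \<open>The supports are disjoint: \<open>\<alpha>\<close> fixes whatever
    \<open>\<beta>\<close> moves.\<close>
  have comp: "(\<alpha> \<circ> \<beta>) i = (if i < k then \<alpha> i else \<beta> i)"
    if "\<alpha> permutes {0..<k}" "\<beta> permutes {k..<k+l}" for \<alpha> \<beta> i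
    using permutes_in_image[OF that(2), of i] permutes_not_in[OF that(2), of i]
      permutes_not_in[OF that(1), of "\<beta> i"] by (cases "i < k"; cases "i < k + l") auto
  show "inj_on (\<lambda>(\<alpha>, \<beta>). ?s \<circ> (\<alpha> \<circ> \<beta>)) ({\<alpha>. \<alpha> permutes {0..<k}} \<times> {\<beta>. \<beta> permutes {k..<k+l}})"
  proof (rule inj_onI, clarify)
    fix \<alpha> \<beta> \<alpha>' \<beta>' :: "nat \<Rightarrow> nat"
    assume perm: "\<alpha> permutes {0..<k}" "\<beta> permutes {k..<k+l}" "\<alpha>' permutes {0..<k}" "\<beta>' permutes {k..<k+l}"
      and eq: "?s \<circ> (\<alpha> \<circ> \<beta>) = ?s \<circ> (\<alpha>' \<circ> \<beta>')"
    have eq': "(\<alpha> \<circ> \<beta>) i = (\<alpha>' \<circ> \<beta>') i" for i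
      using fun_cong[OF eq, of i] inj by (auto dest: injD)
    have "\<alpha> i = \<alpha>' i" for i
      using eq'[of i] permutes_not_in[OF perm(1), of i] permutes_not_in[OF perm(3), of i]
      unfolding comp[OF perm(1,2)] comp[OF perm(3,4)] by (cases "i < k") auto
    moreover have "\<beta> i = \<beta>' i" for i
      using eq'[of i] permutes_not_in[OF perm(2), of i] permutes_not_in[OF perm(4), of i]
      unfolding comp[OF perm(1,2)] comp[OF perm(3,4)] by (cases "i < k") auto
    ultimately show "\<alpha> = \<alpha>' \<and> \<beta> = \<beta>'" by blast
  qed
  show "(\<lambda>(\<alpha>, \<beta>). ?s \<circ> (\<alpha> \<circ> \<beta>)) ` ({\<alpha>. \<alpha> permutes {0..<k}} \<times> {\<beta>. \<beta> permutes {k..<k+l}}) =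
      {p. p permutes {0..<k+l} \<and> p ` {0..<k} = R}"
  proof (intro equalityI subsetI)
    fix p assume "p \<in> (\<lambda>(\<alpha>, \<beta>). ?s \<circ> (\<alpha> \<circ> \<beta>)) ` ({\<alpha>. \<alpha> permutes {0..<k}} \<times> {\<beta>. \<beta> permutes {k..<k+l}})"
    then obtain \<alpha> \<beta> where ab: "\<alpha> permutes {0..<k}" "\<beta> permutes {k..<k+l}" and p: "p = ?s \<circ> (\<alpha> \<circ> \<beta>)"
      by auto
    have "\<alpha> permutes {0..<k+l}" "\<beta> permutes {0..<k+l}"
      using ab by (auto intro: permutes_subset)
    then have "p permutes {0..<k+l}"
      unfolding p using s(1) by (intro permutes_compose)
    moreover have "(\<alpha> \<circ> \<beta>) ` {0..<k} = \<alpha> ` {0..<k}"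
      using comp[OF ab] by (intro image_cong) auto
    then have "p ` {0..<k} = R"
      unfolding p image_comp[symmetric] using permutes_image[OF ab(1)] s(2) by (metis image_comp)
    ultimately show "p \<in> {p. p permutes {0..<k+l} \<and> p ` {0..<k} = R}" by blast
  next
    fix p assume "p \<in> {p. p permutes {0..<k+l} \<and> p ` {0..<k} = R}"
    then have p: "p permutes {0..<k+l}" "p ` {0..<k} = R" by auto
    \<comment> \<open>Removing the representative leaves a permutation that preserves both blocks
      and hence splits.\<close>
    define q where "q = Hilbert_Choice.inv ?s \<circ> p"
    have q: "q permutes {0..<k+l}"
      unfolding q_def using p(1) s(1) by (intro permutes_compose permutes_inv)
    have pq: "p = ?s \<circ> q"
      unfolding q_def using permutes_inv_o(1)[OF s(1)] by (simp add: o_assoc)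
    have im: "q ` {0..<k} = {0..<k}"
    proof -
      have "?s ` (q ` {0..<k}) = ?s ` {0..<k}"
        using p(2) s(2) pq by (metis image_comp)
      then show ?thesis using inj by (simp add: inj_image_eq_iff)
    qed
    have im': "q ` {k..<k+l} = {k..<k+l}"
    proof -
      have "{k..<k+l} = {0..<k+l} - {0..<k}" by auto
      then show ?thesis
        using im permutes_image[OF q] image_set_diff[OF permutes_inj[OF q]] by metis
    qed
    have ab: "restrict_id q {0..<k} permutes {0..<k}" "restrict_id q {k..<k+l} permutes {k..<k+l}"
      using im im' inj_on_subset[OF permutes_inj[OF q]]
      by (auto intro!: permutes_restrict_id simp: bij_betw_def)
    have "q = restrict_id q {0..<k} \<circ> restrict_id q {k..<k+l}"
    proof
      fix i show "q i = (restrict_id q {0..<k} \<circ> restrict_id q {k..<k+l}) i"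
        unfolding comp[OF ab] using permutes_not_in[OF q, of i] by (simp add: restrict_id_def)
    qed
    then show "p \<in> (\<lambda>(\<alpha>, \<beta>). ?s \<circ> (\<alpha> \<circ> \<beta>)) ` ({\<alpha>. \<alpha> permutes {0..<k}} \<times> {\<beta>. \<beta> permutes {k..<k+l}})"
      using pq ab by (intro image_eqI[of _ _ "(restrict_id q {0..<k}, restrict_id q {k..<k+l})"]) auto
  qed
qed

text \<open>The Leibniz terms are grouped by the set of columns used in the first \<open>k\<close>
  rows. Within a group the two blocks are permuted independently, so the sum factors.\<close>

lemma det_rows_laplace:
  fixes A B :: "nat \<Rightarrow> nat \<Rightarrow> 'k :: comm_ring_1"
  shows "Determinant.det (Matrix.mat (k+l) (k+l) (\<lambda>(i, j). if i < k then A i j else B i j)) =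
    (\<Sum>R | R \<subseteq> {0..<k+l} \<and> card R = k. upper_minor k l R A * lower_minor k l R B)"
proof -
  let ?M = "Matrix.mat (k+l) (k+l) (\<lambda>(i, j). if i < k then A i j else B i j)"
  let ?h = "\<lambda>p. signof p * (\<Prod>i = 0..<k+l. ?M $$ (i, p i))"
  let ?P = "{p. p permutes {0..<k+l}}"
  let ?Rs = "{R. R \<subseteq> {0..<k+l} \<and> card R = k}"
  have "Determinant.det ?M = (\<Sum>p\<in>?P. ?h p)"
    by (rule det_def') simp
  also have "\<dots> = (\<Sum>R\<in>?Rs. \<Sum>p\<in>{p\<in>?P. p ` {0..<k} = R}. ?h p)"
  proof (rule sum.group[symmetric])
    show "(\<lambda>p. p ` {0..<k}) ` ?P \<subseteq> ?Rs"
    proof clarify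
      fix p assume p: "p permutes {0..<k+l}"
      have "p ` {0..<k} \<subseteq> p ` {0..<k+l}" by (intro image_mono) auto
      then show "p ` {0..<k} \<subseteq> {0..<k+l} \<and> card (p ` {0..<k}) = k"
        using permutes_image[OF p] card_image[OF inj_on_subset[OF permutes_inj[OF p]], of "{0..<k}"]
        by simp
    qed
  qed (auto simp: finite_permutations)
  also have "\<dots> = (\<Sum>R\<in>?Rs. upper_minor k l R A * lower_minor k l R B)"
  proof (rule sum.cong[OF refl])
    fix R assume "R \<in> ?Rs"
    then have R: "R \<subseteq> {0..<k+l}" "card R = k" by auto
    let ?s = "block_permutation k l R"
    note s = block_permutation(1)[OF R]
    have "(\<Sum>p\<in>{p\<in>?P. p ` {0..<k} = R}. ?h p) =
        (\<Sum>(\<alpha>, \<beta>)\<in>{\<alpha>. \<alpha> permutes {0..<k}} \<times> {\<beta>. \<beta> permutes {k..<k+l}}. ?h (?s \<circ> (\<alpha> \<circ> \<beta>)))"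
      using sum.reindex_bij_betw[OF bij_betw_block_permutations[OF R], of ?h, symmetric]
      by (simp only: case_prod_unfold mem_Collect_eq)
    also have "\<dots> = (\<Sum>(\<alpha>, \<beta>)\<in>{\<alpha>. \<alpha> permutes {0..<k}} \<times> {\<beta>. \<beta> permutes {k..<k+l}}.
        (signof \<alpha> * (\<Prod>i\<in>{0..<k}. A i (?s (\<alpha> i)))) *
        (signof ?s * (signof \<beta> * (\<Prod>i\<in>{k..<k+l}. B i (?s (\<beta> i))))))"
    proof (rule sum.cong[OF refl], clarify)
      fix \<alpha> \<beta> :: "nat \<Rightarrow> nat"
      assume ab: "\<alpha> permutes {0..<k}" "\<beta> permutes {k..<k+l}"
      have ab': "\<alpha> permutes {0..<k+l}" "\<beta> permutes {0..<k+l}"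
        using ab by (auto intro: permutes_subset)
      have perm: "permutation \<alpha>" "permutation \<beta>" "permutation ?s"
        using ab' s by (auto intro: permutation_permutes[THEN iffD2])
      have sgn: "signof (?s \<circ> (\<alpha> \<circ> \<beta>)) = (signof ?s * (signof \<alpha> * signof \<beta>) :: 'k)"
        using perm by (simp add: sign_compose permutation_compose)
      have 1: "?M $$ (i, (?s \<circ> (\<alpha> \<circ> \<beta>)) i) = A i (?s (\<alpha> i))" if "i \<in> {0..<k}" for i
      proof -
        have "\<beta> i = i" using that permutes_not_in[OF ab(2)] by simp
        moreover have "?s (\<alpha> i) < k + l"
          using that permutes_in_image[OF ab'(1), of i] permutes_in_image[OF s, of "\<alpha> i"] by simp
        ultimately show ?thesis using that by simp
      qed
      have 2: "?M $$ (i, (?s \<circ> (\<alpha> \<circ> \<beta>)) i) = B i (?s (\<beta> i))" if "i \<in> {k..<k+l}" for i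
      proof -
        have "\<alpha> (\<beta> i) = \<beta> i"
          using that permutes_in_image[OF ab(2), of i] permutes_not_in[OF ab(1), of "\<beta> i"] by simp
        moreover have "?s (\<beta> i) < k + l"
          using that permutes_in_image[OF ab'(2), of i] permutes_in_image[OF s, of "\<beta> i"] by simp
        ultimately show ?thesis using that by simp
      qed
      have "(\<Prod>i = 0..<k+l. ?M $$ (i, (?s \<circ> (\<alpha> \<circ> \<beta>)) i)) =
          (\<Prod>i\<in>{0..<k}. ?M $$ (i, (?s \<circ> (\<alpha> \<circ> \<beta>)) i)) * (\<Prod>i\<in>{k..<k+l}. ?M $$ (i, (?s \<circ> (\<alpha> \<circ> \<beta>)) i))"
        by (rule prod.atLeastLessThan_concat[symmetric]) auto
      also have "\<dots> = (\<Prod>i\<in>{0..<k}. A i (?s (\<alpha> i))) * (\<Prod>i\<in>{k..<k+l}. B i (?s (\<beta> i)))"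
        using 1 2 by (intro arg_cong2[of _ _ _ _ "(*)"] prod.cong) auto
      finally show "?h (?s \<circ> (\<alpha> \<circ> \<beta>)) = (signof \<alpha> * (\<Prod>i\<in>{0..<k}. A i (?s (\<alpha> i)))) *
        (signof ?s * (signof \<beta> * (\<Prod>i\<in>{k..<k+l}. B i (?s (\<beta> i)))))"
        unfolding sgn by (simp only: mult_ac)
    qed
    also have "\<dots> = upper_minor k l R A * lower_minor k l R B"
      unfolding upper_minor_def lower_minor_def sum_distrib_left[of "signof ?s"]
      by (simp only: sum_product sum.cartesian_product)
    finally show "(\<Sum>p\<in>{p\<in>?P. p ` {0..<k} = R}. ?h p) = upper_minor k l R A * lower_minor k l R B" .
  qed
  finally show ?thesis .
qed

text \<open>Every Leibniz term of this minor uses some entry of column \<open>j\<close>.\<close>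

lemma upper_minor_eq_0:
  assumes "R \<subseteq> {0..<k+l}" and "card R = k" and "j \<in> R" and "\<And>i. i < k \<Longrightarrow> A i j = 0"
  shows "upper_minor k l R A = 0"
  unfolding upper_minor_def
proof (rule sum.neutral, clarify)
  fix \<alpha> assume "\<alpha> permutes {0..<k}"
  then have "block_permutation k l R ` (\<alpha> ` {0..<k}) = R"
    using block_permutation(2)[OF assms(1,2)] by (simp add: permutes_image)
  then have "j \<in> block_permutation k l R ` (\<alpha> ` {0..<k})"
    using assms(3) by simp
  then obtain i where "i < k" "block_permutation k l R (\<alpha> i) = j" by auto
  then have "A i (block_permutation k l R (\<alpha> i)) = 0" using assms(4) by simp
  then have "(\<Prod>i\<in>{0..<k}. A i (block_permutation k l R (\<alpha> i))) = 0"
    using \<open>i < k\<close> by (intro prod_zero) auto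
  then show "signof \<alpha> * (\<Prod>i\<in>{0..<k}. A i (block_permutation k l R (\<alpha> i))) = 0" by simp
qed

text \<open>A column outside \<open>R\<close> belongs to the complementary minor, so each of its
  Leibniz terms has a zero factor.\<close>

lemma lower_minor_eq_0:
  assumes "R \<subseteq> {0..<k+l}" and "card R = k" and "j < k + l" "j \<notin> R"
    and "\<And>i. k \<le> i \<Longrightarrow> i < k + l \<Longrightarrow> B i j = 0"
  shows "lower_minor k l R B = 0"
proof -
  let ?s = "block_permutation k l R"
  note s = block_permutation[OF assms(1,2)]
  have "{k..<k+l} = {0..<k+l} - {0..<k}" by auto
  then have im: "?s ` {k..<k+l} = {0..<k+l} - R"
    using s(2) permutes_image[OF s(1)] image_set_diff[OF permutes_inj[OF s(1)]] by metis
  have "(\<Prod>i\<in>{k..<k+l}. B i (?s (\<beta> i))) = 0" if "\<beta> permutes {k..<k+l}" for \<beta>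
  proof -
    have "j \<in> ?s ` (\<beta> ` {k..<k+l})"
      using that im assms(3,4) by (simp add: permutes_image)
    then obtain i where "i \<in> {k..<k+l}" "?s (\<beta> i) = j" by (auto simp: image_iff)
    then have "B i (?s (\<beta> i)) = 0" using assms(5) by simp
    then show ?thesis using \<open>i \<in> {k..<k+l}\<close> by (intro prod_zero) auto
  qed
  then show ?thesis by (simp add: lower_minor_def)
qed

section \<open>Generic choice along lines\<close>

lemma det_line_poly:
  fixes M M' :: "nat \<Rightarrow> nat \<Rightarrow> 'k :: comm_ring_1"
  shows "\<exists>p. \<forall>z. poly p z =
    Determinant.det (Matrix.mat N N (\<lambda>(i, j). (1 - z) * M i j + z * M' i j))"
proof -
  \<comment> \<open>The determinant is taken over the polynomial ring; evaluation at
    \<open>z\<close> is a ring homomorphism and commutes with it.\<close>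
  let ?P = "Matrix.mat N N (\<lambda>(i, j). [:M i j, M' i j - M i j:])"
  have "poly (Determinant.det ?P) z =
      Determinant.det (Matrix.mat N N (\<lambda>(i, j). (1 - z) * M i j + z * M' i j))" for z
  proof -
    have hom: "comm_ring_hom (\<lambda>p :: 'k poly. poly p z)" by unfold_locales auto
    have "map_mat (\<lambda>p. poly p z) ?P = Matrix.mat N N (\<lambda>(i, j). (1 - z) * M i j + z * M' i j)"
      by (rule eq_matI) (auto simp: algebra_simps)
    then show ?thesis using comm_ring_hom.hom_det[OF hom, of ?P] by simp
  qed
  then show ?thesis by blast
qed

text \<open>A point good for \<open>I\<close> and a point good for \<open>j\<close> are joined by a
  line. Every \<open>d i\<close> is a nonzero polynomial on it, and an infinite field has a point
  outside the finitely many roots. Working with lines avoids polynomials in several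
  variables.\<close>

lemma common_nonvanishing_point:
  fixes d :: "'i \<Rightarrow> 'p \<Rightarrow> 'k :: field" and line :: "'k \<Rightarrow> 'p \<Rightarrow> 'p \<Rightarrow> 'p"
  assumes "infinite (UNIV :: 'k set)" and "finite I" and "T \<noteq> {}"
    and closed: "\<And>z x y. x \<in> T \<Longrightarrow> y \<in> T \<Longrightarrow> line z x y \<in> T"
    and poly: "\<And>i x y. \<exists>p. \<forall>z. poly p z = d i (line z x y)"
    and line: "\<And>x y. line 0 x y = x" "\<And>x y. line 1 x y = y"
    and pointwise: "\<And>i. i \<in> I \<Longrightarrow> \<exists>x\<in>T. d i x \<noteq> 0"
  shows "\<exists>x\<in>T. \<forall>i\<in>I. d i x \<noteq> 0"
  using assms(2) pointwise
proof (induction I rule: finite_induct)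
  case empty
  then show ?case using assms(3) by blast
next
  case (insert j I)
  then obtain x y where x: "x \<in> T" "\<And>i. i \<in> I \<Longrightarrow> d i x \<noteq> 0" and y: "y \<in> T" "d j y \<noteq> 0"
    by (metis insert_iff)
  have "\<exists>p. \<forall>i z. poly (p i) z = d i (line z x y)"
    using poly by (intro choice allI)
  then obtain p where p: "\<And>i z. poly (p i) z = d i (line z x y)" by blast
  \<comment> \<open>The line passes through \<open>x\<close> at \<open>z = 0\<close>, which settles
    \<open>I\<close>, and through \<open>y\<close> at \<open>z = 1\<close>, which settles
    \<open>j\<close>.\<close>
  have "p i \<noteq> 0" if "i \<in> insert j I" for i
    using that x(2) y(2) p[of i 0] p[of i 1] by (auto simp: line)
  then have "(\<Prod>i\<in>insert j I. p i) \<noteq> 0"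
    using insert.hyps by (simp only: prod_zero_iff finite_insert) blast
  then have "finite {z. poly (\<Prod>i\<in>insert j I. p i) z = 0}" by (rule poly_roots_finite)
  then obtain z where "poly (\<Prod>i\<in>insert j I. p i) z \<noteq> 0"
    using assms(1) by (metis (mono_tags, lifting) finite_subset mem_Collect_eq subsetI)
  then have "\<forall>i\<in>insert j I. d i (line z x y) \<noteq> 0"
    using insert.hyps by (simp only: poly_prod prod_zero_iff finite_insert p) blast
  then show ?case using closed x(1) y(1) by blast
qed

section \<open>Subspaces with a skew intersection pattern\<close>

text \<open>For a field embedding \<open>h\<close>, these are the restrictions of linear functionals
  on the space with scalars extended along \<open>h\<close>; the extended space itself never has to
  be formed.\<close>

definition semilinear :: "('a :: field \<Rightarrow> 'k :: field) \<Rightarrow> ('a ^ 'n \<Rightarrow> 'k) \<Rightarrow> bool" where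
  "semilinear h f \<longleftrightarrow> (\<forall>u v. f (u + v) = f u + f v) \<and> (\<forall>c u. f (c *s u) = h c * f u)"

lemma semilinear_sum:
  assumes "semilinear h f" and "h 0 = 0"
  shows "f (\<Sum>i\<in>I. c i *s u i) = (\<Sum>i\<in>I. h (c i) * f (u i))"
proof -
  have "f 0 = 0" using assms unfolding semilinear_def by (metis mult_zero_left vec.scale_zero_left)
  then show ?thesis
    using assms by (induction I rule: infinite_finite_induct) (auto simp: semilinear_def)
qed

lemma span_enumerated:
  fixes a :: "nat \<Rightarrow> 'a :: field ^ 'n"
  assumes "inj_on a {..<k}" and "v \<in> vec.span (a ` {..<k})"
  shows "\<exists>x. v = (\<Sum>i<k. x i *s a i)"
proof -
  obtain u where "v = (\<Sum>b\<in>a ` {..<k}. u b *s b)"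
    using assms(2) by (auto simp: vec.span_finite)
  then show ?thesis
    using assms(1) by (intro exI[of _ "u \<circ> a"]) (simp add: sum.reindex)
qed

lemma sum_lessThan_add: "(\<Sum>i<k+l. f i) = (\<Sum>i<k. f i) + (\<Sum>i<(l::nat). f (k + i) :: 'b :: comm_monoid_add)"
  by (induction l) (auto simp: add_ac)

text \<open>
  The rows of the pairing determinant are \<open>(\<phi> a, \<psi> a, 0)\<close> for the basis vectors \<open>a\<close> of one subspace
  and \<open>(\<phi> b, 0, \<psi> b)\<close> for those of the other, where \<open>\<phi>\<close> are the first \<open>2 * e\<close> functionals of \<open>\<theta>\<close>
  and \<open>\<psi>\<close> the next \<open>t\<close>. It is nonzero iff \<open>\<phi>\<close> is injective on the direct sum of the two
  intersections with the common kernel of \<open>\<psi>\<close>.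
\<close>

definition left_row :: "nat \<Rightarrow> nat \<Rightarrow> (nat \<Rightarrow> 'v \<Rightarrow> 'k :: zero) \<Rightarrow> 'v \<Rightarrow> nat \<Rightarrow> 'k" where
  "left_row e t \<theta> v j = (if j < 2 * e + t then \<theta> j v else 0)"

definition right_row :: "nat \<Rightarrow> nat \<Rightarrow> (nat \<Rightarrow> 'v \<Rightarrow> 'k :: zero) \<Rightarrow> 'v \<Rightarrow> nat \<Rightarrow> 'k" where
  "right_row e t \<theta> v j = (if j < 2 * e then \<theta> j v else if j < 2 * e + t then 0 else \<theta> (j - t) v)"

definition pairing_entry ::
    "nat \<Rightarrow> nat \<Rightarrow> (nat \<Rightarrow> 'v \<Rightarrow> 'k :: zero) \<Rightarrow> (nat \<Rightarrow> 'v) \<Rightarrow> (nat \<Rightarrow> 'v) \<Rightarrow> nat \<Rightarrow> nat \<Rightarrow> 'k" where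
  "pairing_entry e t \<theta> a b i j =
    (if i < e + t then left_row e t \<theta> (a i) j else right_row e t \<theta> (b (i - (e + t))) j)"

definition pairing_det ::
    "nat \<Rightarrow> nat \<Rightarrow> (nat \<Rightarrow> 'v \<Rightarrow> 'k :: comm_ring_1) \<Rightarrow> (nat \<Rightarrow> 'v) \<Rightarrow> (nat \<Rightarrow> 'v) \<Rightarrow> 'k" where
  "pairing_det e t \<theta> a b = Determinant.det (Matrix.mat (e + t + (e + t)) (e + t + (e + t))
    (\<lambda>(i, j). pairing_entry e t \<theta> a b i j))"

section \<open>Vanishing and nonvanishing of the pairing determinant\<close>

lemma pairing_det_eq_0_iff:
  fixes \<theta> :: "nat \<Rightarrow> 'v \<Rightarrow> 'k :: field"
  shows "pairing_det e t \<theta> a b = 0 \<longleftrightarrow> (\<exists>x y. (\<exists>i<e+t. x i \<noteq> 0 \<or> y i \<noteq> 0) \<and>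
    (\<forall>j<2*e. (\<Sum>i<e+t. x i * \<theta> j (a i)) + (\<Sum>i<e+t. y i * \<theta> j (b i)) = 0) \<and>
    (\<forall>j\<in>{2*e..<2*e+t}. (\<Sum>i<e+t. x i * \<theta> j (a i)) = 0 \<and> (\<Sum>i<e+t. y i * \<theta> j (b i)) = 0))"
    (is "_ \<longleftrightarrow> ?R")
proof -
  let ?N = "e + t + (e + t)"
  have cols: "(\<forall>j<?N. (\<Sum>i<?N. w i * pairing_entry e t \<theta> a b i j) = 0) \<longleftrightarrow>
    (\<forall>j<2*e. (\<Sum>i<e+t. w i * \<theta> j (a i)) + (\<Sum>i<e+t. w (e + t + i) * \<theta> j (b i)) = 0) \<and>
    (\<forall>j\<in>{2*e..<2*e+t}. (\<Sum>i<e+t. w i * \<theta> j (a i)) = 0 \<and> (\<Sum>i<e+t. w (e + t + i) * \<theta> j (b i)) = 0)"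
    (is "?C \<longleftrightarrow> ?E") for w
  proof -
    have sum: "(\<Sum>i<?N. w i * pairing_entry e t \<theta> a b i j) =
        (\<Sum>i<e+t. w i * left_row e t \<theta> (a i) j) + (\<Sum>i<e+t. w (e + t + i) * right_row e t \<theta> (b i) j)" for j
      unfolding sum_lessThan_add[of _ "e + t" "e + t"] by (simp add: pairing_entry_def)
    show ?thesis
    proof
      assume C: ?C
      show ?E
      proof (intro conjI allI impI ballI)
        fix j assume "j < 2 * e"
        then show "(\<Sum>i<e+t. w i * \<theta> j (a i)) + (\<Sum>i<e+t. w (e + t + i) * \<theta> j (b i)) = 0"
          using C[rule_format, of j] unfolding sum by (simp add: left_row_def right_row_def)
      next
        fix j assume "j \<in> {2*e..<2*e+t}"
        then show "(\<Sum>i<e+t. w i * \<theta> j (a i)) = 0"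
          using C[rule_format, of j] unfolding sum by (simp add: left_row_def right_row_def)
      next
        fix j assume "j \<in> {2*e..<2*e+t}"
        \<comment> \<open>In the right rows the functional \<open>j\<close> stands in column
          \<open>j + t\<close>, since their middle block is zero.\<close>
        then show "(\<Sum>i<e+t. w (e + t + i) * \<theta> j (b i)) = 0"
          using C[rule_format, of "j + t"] unfolding sum by (simp add: left_row_def right_row_def)
      qed
    next
      assume E: ?E
      show ?C
      proof (intro allI impI)
        fix j assume "j < ?N"
        then consider "j < 2 * e" | "j \<in> {2*e..<2*e+t}" | "2 * e + t \<le> j" "j - t \<in> {2*e..<2*e+t}"
          by fastforce
        then show "(\<Sum>i<?N. w i * pairing_entry e t \<theta> a b i j) = 0"
          unfolding sum using E by cases (auto simp: left_row_def right_row_def)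
      qed
    qed
  qed
  have "pairing_det e t \<theta> a b = 0 \<longleftrightarrow>
      (\<exists>w. (\<exists>i<?N. w i \<noteq> 0) \<and> (\<forall>j<?N. (\<Sum>i<?N. w i * pairing_entry e t \<theta> a b i j) = 0))"
    unfolding pairing_det_def by (rule det_mat_eq_0_iff)
  also have "\<dots> \<longleftrightarrow> ?R"
  proof
    assume "\<exists>w. (\<exists>i<?N. w i \<noteq> 0) \<and> (\<forall>j<?N. (\<Sum>i<?N. w i * pairing_entry e t \<theta> a b i j) = 0)"
    then obtain w i where w: "i < ?N" "w i \<noteq> 0"
      "\<forall>j<?N. (\<Sum>i<?N. w i * pairing_entry e t \<theta> a b i j) = 0"
      by blast
    have "\<exists>i<e+t. w i \<noteq> 0 \<or> w (e + t + i) \<noteq> 0"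
    proof (cases "i < e + t")
      case False
      then show ?thesis using w(1,2) by (intro exI[of _ "i - (e + t)"]) auto
    qed (use w in blast)
    then show ?R
      using w(3) unfolding cols by (intro exI[of _ w] exI[of _ "\<lambda>i. w (e + t + i)"]) simp
  next
    assume ?R
    then obtain x y i where xy: "i < e + t" "x i \<noteq> 0 \<or> y i \<noteq> 0"
      "\<forall>j<2*e. (\<Sum>i<e+t. x i * \<theta> j (a i)) + (\<Sum>i<e+t. y i * \<theta> j (b i)) = 0"
      "\<forall>j\<in>{2*e..<2*e+t}. (\<Sum>i<e+t. x i * \<theta> j (a i)) = 0 \<and> (\<Sum>i<e+t. y i * \<theta> j (b i)) = 0"
      by blast
    define w where "w = (\<lambda>i. if i < e + t then x i else y (i - (e + t)))"
    have "\<exists>i<?N. w i \<noteq> 0"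
    proof (cases "x i = 0")
      case True
      then show ?thesis using xy(1,2) by (intro exI[of _ "e + t + i"]) (simp add: w_def)
    next
      case False
      then show ?thesis using xy(1) by (intro exI[of _ i]) (simp add: w_def)
    qed
    moreover have "\<forall>j<?N. (\<Sum>i<?N. w i * pairing_entry e t \<theta> a b i j) = 0"
      unfolding cols using xy(3,4) by (simp add: w_def)
    ultimately show "\<exists>w. (\<exists>i<?N. w i \<noteq> 0) \<and> (\<forall>j<?N. (\<Sum>i<?N. w i * pairing_entry e t \<theta> a b i j) = 0)"
      by blast
  qed
  finally show ?thesis .
qed

text \<open>After extension of scalars, the intersection contains a nonzero vector killed by the
  \<open>t\<close> middle functionals. Its coordinates in \<open>a\<close>, together with the
  negated ones in \<open>b\<close>, give a dependence of the rows.\<close>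

lemma pairing_det_eq_0:
  fixes \<theta> :: "nat \<Rightarrow> 'a :: field ^ 'n \<Rightarrow> 'k :: field"
  assumes h: "field_hom h" and \<theta>: "\<And>r. semilinear h (\<theta> r)"
    and a: "inj_on a {..<e+t}" "A \<subseteq> vec.span (a ` {..<e+t})"
    and b: "inj_on b {..<e+t}" "B \<subseteq> vec.span (b ` {..<e+t})"
    and dim: "t < vec.dim (A \<inter> B)"
  shows "pairing_det e t \<theta> a b = 0"
proof -
  interpret h: field_hom h by fact
  let ?k = "e + t"
  obtain C where C: "C \<subseteq> A \<inter> B" "vec.independent C" "card C = vec.dim (A \<inter> B)"
    by (metis vec.basis_exists)
  then obtain C' where C': "C' \<subseteq> C" "card C' = Suc t" "finite C'"
    using dim obtain_subset_with_card_n[of "Suc t" C] by (metis Suc_leI)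
  have indC': "vec.independent C'" using C(2) C'(1) vec.independent_mono by blast
  obtain v where v: "bij_betw v {0..<Suc t} C'"
    using ex_bij_betw_nat_finite[OF C'(3)] C'(2) by auto
  have v_in: "v l \<in> C'" if "l < Suc t" for l
    using that v by (auto simp: bij_betw_def)
  have "\<exists>x. v l = (\<Sum>i<?k. x i *s a i)" if "l < Suc t" for l
    using span_enumerated[OF a(1)] v_in[OF that] C(1) C'(1) a(2) by blast
  then obtain x where x: "\<And>l. l < Suc t \<Longrightarrow> v l = (\<Sum>i<?k. x l i *s a i)" by metis
  have "\<exists>y. v l = (\<Sum>i<?k. y i *s b i)" if "l < Suc t" for l
    using span_enumerated[OF b(1)] v_in[OF that] C(1) C'(1) b(2) by blast
  then obtain y where y: "\<And>l. l < Suc t \<Longrightarrow> v l = (\<Sum>i<?k. y l i *s b i)" by metis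
  \<comment> \<open>There are \<open>t\<close> equations for \<open>t + 1\<close> unknowns.\<close>
  obtain c where c: "\<exists>l<Suc t. c l \<noteq> 0"
    "\<And>r. r \<in> {2*e..<2*e+t} \<Longrightarrow> (\<Sum>l<Suc t. c l * \<theta> r (v l)) = 0"
    using homogeneous_system_nontrivial[of "{2*e..<2*e+t}" "Suc t" "\<lambda>r l. \<theta> r (v l)"]
    by (simp only: card_atLeastLessThan finite_atLeastLessThan diff_add_inverse lessI) blast
  \<comment> \<open>\<open>X\<close> and \<open>Y\<close> are the coordinates in \<open>a\<close>
    and \<open>b\<close> of the combination of the \<open>v l\<close> with coefficients
    \<open>c l\<close>. Its scalars lie in the larger field, so it is a formal vector, seen only
    through semilinear functionals.\<close>
  define X where "X = (\<lambda>i. \<Sum>l<Suc t. c l * h (x l i))"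
  define Y where "Y = (\<lambda>i. \<Sum>l<Suc t. c l * h (y l i))"
  have combine: "(\<Sum>i<?k. (\<Sum>l<Suc t. c l * h (z l i)) * f (d i)) = (\<Sum>l<Suc t. c l * f (v l))"
    if "semilinear h f" and z: "\<And>l. l < Suc t \<Longrightarrow> v l = (\<Sum>i<?k. z l i *s d i)"
    for f z and d :: "nat \<Rightarrow> 'a ^ 'n"
  proof -
    have "(\<Sum>i<?k. (\<Sum>l<Suc t. c l * h (z l i)) * f (d i)) =
        (\<Sum>l<Suc t. \<Sum>i<?k. c l * (h (z l i) * f (d i)))"
      unfolding sum_distrib_right by (subst sum.swap) (simp only: mult.assoc)
    also have "\<dots> = (\<Sum>l<Suc t. c l * f (v l))"
      by (intro sum.cong refl)
        (simp only: lessThan_iff z semilinear_sum[OF that(1) h.hom_zero] sum_distrib_left)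
    finally show ?thesis .
  qed
  have X: "(\<Sum>i<?k. X i * f (a i)) = (\<Sum>l<Suc t. c l * f (v l))" if "semilinear h f" for f
    unfolding X_def by (rule combine[OF that x])
  have Y: "(\<Sum>i<?k. Y i * f (b i)) = (\<Sum>l<Suc t. c l * f (v l))" if "semilinear h f" for f
    unfolding Y_def by (rule combine[OF that y])
  have "\<exists>i<?k. X i \<noteq> 0"
  proof (rule ccontr)
    assume X0: "\<not> (\<exists>i<?k. X i \<noteq> 0)"
    obtain l where l: "l < Suc t" "c l \<noteq> 0" using c(1) by blast
    define E where "E = vec.extend_basis C'"
    have E: "C' \<subseteq> E" "vec.independent E" "vec.span E = UNIV"
      unfolding E_def using indC' vec.extend_basis_superset vec.independent_extend_basis
        vec.span_extend_basis by blast+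
    \<comment> \<open>The coordinate functional at \<open>v l\<close> sends the formal vector to
      \<open>c l\<close>, but to 0 if all \<open>X i\<close> vanish.\<close>
    define f where "f = (\<lambda>u. h (vec.representation E u (v l)))"
    have "semilinear h f"
      unfolding semilinear_def f_def using E
      by (simp add: vec.representation_add vec.representation_scale h.hom_add h.hom_mult)
    then have "(\<Sum>l'<Suc t. c l' * f (v l')) = 0"
      using X0 by (subst X[symmetric]) (auto intro!: sum.neutral)
    moreover have "f (v l') = (if l' = l then 1 else 0)" if "l' < Suc t" for l'
    proof -
      have "v l \<in> E" "v l' \<in> E" using v_in that l(1) E(1) by blast+
      moreover have "v l' = v l \<longleftrightarrow> l' = l"
        using v that l(1) by (auto simp: bij_betw_def inj_on_def)
      ultimately show ?thesis
        unfolding f_def using E(2) by (auto simp: vec.representation_basis)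
    qed
    then have "(\<Sum>l'<Suc t. c l' * f (v l')) = (\<Sum>l'<Suc t. if l' = l then c l' else 0)"
      by (intro sum.cong) auto
    ultimately show False using l by (simp del: sum.lessThan_Suc)
  qed
  moreover have "(\<Sum>i<?k. - Y i * f (b i)) = - (\<Sum>l<Suc t. c l * f (v l))" if "semilinear h f" for f
    using Y[OF that] by (simp add: sum_negf del: sum.lessThan_Suc)
  ultimately show ?thesis
    unfolding pairing_det_eq_0_iff
    by (intro exI[of _ X] exI[of _ "\<lambda>i. - Y i"] conjI) (auto simp: X \<theta> c(2) simp del: sum.lessThan_Suc)
qed

text \<open>For a single pair no generic choice is needed: the functionals are built from
  coordinates in a basis adapted to \<open>A\<close>, \<open>B\<close> and
  \<open>A \<inter> B\<close>.\<close>

lemma separating_functionals: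
  fixes A B :: "('a :: field ^ 'n) set"
  assumes A: "vec.subspace A" "vec.dim A = e + t" and B: "vec.subspace B" "vec.dim B = e + t"
    and dim: "vec.dim (A \<inter> B) \<le> t"
  shows "\<exists>\<theta>. (\<forall>r. semilinear (\<lambda>c. c) (\<theta> r)) \<and> (\<forall>u\<in>A. \<forall>u'\<in>B.
    (\<forall>j<2*e. \<theta> j u + \<theta> j u' = 0) \<longrightarrow> (\<forall>j\<in>{2*e..<2*e+t}. \<theta> j u = 0 \<and> \<theta> j u' = 0) \<longrightarrow>
    u = 0 \<and> u' = 0)"
proof -
  define d where "d = vec.dim (A \<inter> B)"
  obtain C where C: "C \<subseteq> A \<inter> B" "vec.independent C" "A \<inter> B \<subseteq> vec.span C" "card C = d"
    unfolding d_def by (rule vec.basis_exists)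
  obtain CA where CA: "C \<subseteq> CA" "CA \<subseteq> A" "vec.independent CA" "A \<subseteq> vec.span CA"
    using vec.maximal_independent_subset_extend[of C A] C by blast
  obtain CB where CB: "C \<subseteq> CB" "CB \<subseteq> B" "vec.independent CB" "B \<subseteq> vec.span CB"
    using vec.maximal_independent_subset_extend[of C B] C by blast
  have fin: "finite CA" "finite CB" "finite C"
    using CA(3) CB(3) C(2) vec.finiteI_independent by blast+
  have card: "card CA = e + t" "card CB = e + t"
    using vec.basis_card_eq_dim[OF CA(2,4,3)] vec.basis_card_eq_dim[OF CB(2,4,3)] A(2) B(2) by auto
  let ?S = "{x + y |x y. x \<in> A \<and> y \<in> B}"
  have sub: "CA \<union> CB \<subseteq> ?S"
  proof -
    have "x + 0 \<in> ?S" if "x \<in> A" for x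
      using that vec.subspace_0[OF B(1)] by blast
    moreover have "0 + x \<in> ?S" if "x \<in> B" for x
      using that vec.subspace_0[OF A(1)] by blast
    ultimately show ?thesis using CA(2) CB(2) by (simp only: add_0_left add_0_right) blast
  qed
  have spanS: "?S \<subseteq> vec.span (CA \<union> CB)"
    using CA(4) CB(4) vec.span_mono[of CA "CA \<union> CB"] vec.span_mono[of CB "CA \<union> CB"]
    by (auto intro!: vec.span_add)
  \<comment> \<open>So far only \<open>C \<subseteq> CA \<inter> CB\<close> is known. This bounds
    the union by the dimension of the sum that it spans, so it is independent, and equality follows
    from that.\<close>
  have "card (CA \<union> CB) + card (CA \<inter> CB) = (e + t) + (e + t)"
    using card_Un_Int[OF fin(1,2)] card by simp
  moreover have "d \<le> card (CA \<inter> CB)"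
    using C(4) CA(1) CB(1) fin by (metis Int_subset_iff card_mono finite_Int)
  moreover have dimS: "vec.dim ?S + d = (e + t) + (e + t)"
    using vec.dim_sums_Int[OF A(1) B(1)] A(2) B(2) by (simp add: d_def)
  ultimately have cardU: "card (CA \<union> CB) \<le> vec.dim ?S" by linarith
  have indU: "vec.independent (CA \<union> CB)"
    by (rule vec.card_le_dim_spanning[OF sub spanS _ cardU]) (use fin in auto)
  have dimU: "card (CA \<union> CB) = vec.dim ?S"
    using vec.basis_card_eq_dim[OF sub spanS indU] .
  have "card (CA \<inter> CB) = d"
    using \<open>card (CA \<union> CB) + card (CA \<inter> CB) = (e + t) + (e + t)\<close> dimS dimU by linarith
  then have CAB: "CA \<inter> CB = C"
    using C(4) CA(1) CB(1) fin by (intro card_subset_eq[symmetric]) auto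
  define E where "E = vec.extend_basis (CA \<union> CB)"
  have E: "CA \<union> CB \<subseteq> E" "vec.independent E" "vec.span E = UNIV"
    unfolding E_def using indU vec.extend_basis_superset vec.independent_extend_basis
      vec.span_extend_basis by blast+
  define g where "g = (\<lambda>x u. vec.representation E u x)"
  have g_lin: "semilinear (\<lambda>c. c) (g x)" for x
    unfolding semilinear_def g_def using E
    by (simp add: vec.representation_add vec.representation_scale)
  have g_outside: "g x u = 0" if "u \<in> vec.span D" "D \<subseteq> CA \<union> CB" "x \<notin> D" for x u D
  proof -
    have "vec.representation E u = vec.representation D u"
      using vec.representation_extend[OF E(2) that(1)] that(2) E(1) by blast
    then show ?thesis
      using vec.representation_ne_zero[of D u x] that(3) unfolding g_def by fastforce
  qed
  have g_zero: "u = 0" if "u \<in> vec.span D" "D \<subseteq> CA \<union> CB" "\<And>x. x \<in> D \<Longrightarrow> g x u = 0" for u D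
  proof -
    have "vec.representation E u x = 0" for x
      using that g_outside[OF that(1,2)] unfolding g_def by (cases "x \<in> D") auto
    then show ?thesis
      using vec.sum_nonzero_representation_eq[OF E(2), of u] E(3) by simp
  qed
  have cd: "card (CA - C) = e + t - d" "card (CB - C) = e + t - d"
    using CA(1) CB(1) C(4) card fin by (simp_all add: card_Diff_subset)
  obtain c where c: "bij_betw c {0..<d} C"
    using ex_bij_betw_nat_finite[OF fin(3)] C(4) by auto
  obtain p where p: "bij_betw p {0..<e+t-d} (CA - C)"
    using ex_bij_betw_nat_finite[of "CA - C"] cd(1) fin by auto
  obtain r where r: "bij_betw r {0..<e+t-d} (CB - C)"
    using ex_bij_betw_nat_finite[of "CB - C"] cd(2) fin by auto
  \<comment> \<open>The last \<open>t\<close> functionals kill \<open>C\<close> and the first \<open>t - d\<close> vectors of \<open>CA - C\<close> and of \<open>CB - C\<close>: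
    the latter are paired up because these functionals see \<open>u\<close> and \<open>u'\<close> separately. The first
    \<open>2 * e\<close> functionals read off the remaining coordinates.\<close>
  define \<theta> where "\<theta> = (\<lambda>j.
    if j < e then g (p (t - d + j))
    else if j < 2 * e then g (r (t - d + (j - e)))
    else if j < 2 * e + d then g (c (j - 2 * e))
    else (\<lambda>u. g (p (j - 2 * e - d)) u + g (r (j - 2 * e - d)) u))"
  have dt: "d \<le> t" using dim d_def by simp
  have "semilinear (\<lambda>c. c) (\<theta> j)" for j
    using g_lin unfolding \<theta>_def semilinear_def by (auto simp: algebra_simps)
  moreover have "u = 0 \<and> u' = 0" if u: "u \<in> A" "u' \<in> B" and low: "\<forall>j<2*e. \<theta> j u + \<theta> j u' = 0"
    and high: "\<forall>j\<in>{2*e..<2*e+t}. \<theta> j u = 0 \<and> \<theta> j u' = 0" for u u'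
  proof -
    have gr: "g (r i) u = 0" if "i < e + t - d" for i
    proof (rule g_outside[of _ CA])
      have "r i \<in> CB - C" using that r by (auto simp: bij_betw_def)
      then show "r i \<notin> CA" using CAB by blast
    qed (use u CA(4) in auto)
    have gp: "g (p i) u' = 0" if "i < e + t - d" for i
    proof (rule g_outside[of _ CB])
      have "p i \<in> CA - C" using that p by (auto simp: bij_betw_def)
      then show "p i \<notin> CB" using CAB by blast
    qed (use u CB(4) in auto)
    have onC: "g x u = 0 \<and> g x u' = 0" if "x \<in> C" for x
    proof -
      have "x \<in> c ` {0..<d}" using that bij_betw_imp_surj_on[OF c] by simp
      then obtain i where "i < d" "x = c i" by auto
      then show ?thesis using high[rule_format, of "2 * e + i"] dt by (simp add: \<theta>_def)
    qed
    have onA: "g (p i) u = 0" and onB: "g (r i) u' = 0" if i: "i < e + t - d" for i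
    proof -
      have "g (p i) u = 0 \<and> g (r i) u' = 0"
      proof (cases "i < t - d")
        case True
        then show ?thesis
          using high[rule_format, of "2 * e + d + i"] gr[OF i] gp[OF i] by (simp add: \<theta>_def)
      next
        case False
        define j where "j = i - (t - d)"
        have j: "j < e" "i = t - d + j" using i False dt by (auto simp: j_def)
        then show ?thesis
          using low[rule_format, of j] low[rule_format, of "e + j"] gr[OF i] gp[OF i]
          by (simp add: \<theta>_def)
      qed
      then show "g (p i) u = 0" "g (r i) u' = 0" by auto
    qed
    have "u = 0"
    proof (rule g_zero[of _ CA])
      fix x assume "x \<in> CA"
      show "g x u = 0"
      proof (cases "x \<in> C")
        case False
        then have "x \<in> p ` {0..<e+t-d}" using \<open>x \<in> CA\<close> bij_betw_imp_surj_on[OF p] by simp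
        then show ?thesis using onA by auto
      qed (use onC in blast)
    qed (use u CA(4) in auto)
    moreover have "u' = 0"
    proof (rule g_zero[of _ CB])
      fix x assume "x \<in> CB"
      show "g x u' = 0"
      proof (cases "x \<in> C")
        case False
        then have "x \<in> r ` {0..<e+t-d}" using \<open>x \<in> CB\<close> bij_betw_imp_surj_on[OF r] by simp
        then show ?thesis using onB by auto
      qed (use onC in blast)
    qed (use u CB(4) in auto)
    ultimately show ?thesis by blast
  qed
  ultimately show ?thesis by (intro exI[of _ \<theta>]) blast
qed

lemma independent_enumerated:
  fixes a :: "nat \<Rightarrow> 'a :: field ^ 'n"
  assumes "inj_on a {..<k}" and "vec.independent (a ` {..<k})"
    and "(\<Sum>i<k. x i *s a i) = 0" and "i < k"
  shows "x i = 0"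
proof -
  have "(\<Sum>v\<in>a ` {..<k}. x (the_inv_into {..<k} a v) *s v) = 0"
    using assms(1,3) by (simp add: sum.reindex the_inv_into_f_f)
  then have "x (the_inv_into {..<k} a (a i)) = 0"
    using assms(2,4) vec.independentD[OF assms(2), of "a ` {..<k}" "\<lambda>v. x (the_inv_into {..<k} a v)" "a i"]
    by simp
  then show ?thesis using assms(1,4) by (simp add: the_inv_into_f_f)
qed

text \<open>Functionals over the small field are composed with \<open>h\<close>: the determinant is
  then the image under \<open>h\<close> of a nonzero element, and field homomorphisms are
  injective.\<close>

lemma exists_pairing_det_nonzero:
  fixes A B :: "('a :: field ^ 'n) set" and h :: "'a \<Rightarrow> 'k :: field"
  assumes h: "field_hom h"
    and A: "vec.subspace A" "vec.dim A = e + t" and B: "vec.subspace B" "vec.dim B = e + t"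
    and dim: "vec.dim (A \<inter> B) \<le> t"
    and a: "inj_on a {..<e+t}" "vec.independent (a ` {..<e+t})" "a ` {..<e+t} \<subseteq> A"
    and b: "inj_on b {..<e+t}" "vec.independent (b ` {..<e+t})" "b ` {..<e+t} \<subseteq> B"
  shows "\<exists>\<theta>. (\<forall>r. semilinear h (\<theta> r)) \<and> pairing_det e t \<theta> a b \<noteq> 0"
proof -
  interpret h: field_hom h by fact
  obtain \<theta> where \<theta>: "\<And>r. semilinear (\<lambda>c. c) (\<theta> r)"
    and inj: "\<And>u u'. u \<in> A \<Longrightarrow> u' \<in> B \<Longrightarrow> \<forall>j<2*e. \<theta> j u + \<theta> j u' = 0 \<Longrightarrow>
      \<forall>j\<in>{2*e..<2*e+t}. \<theta> j u = 0 \<and> \<theta> j u' = 0 \<Longrightarrow> u = 0 \<and> u' = 0"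
    using separating_functionals[OF A B dim] by metis
  have "pairing_det e t \<theta> a b \<noteq> 0"
  proof
    assume "pairing_det e t \<theta> a b = 0"
    then obtain x y where xy: "\<exists>i<e+t. x i \<noteq> 0 \<or> y i \<noteq> 0"
      "\<forall>j<2*e. (\<Sum>i<e+t. x i * \<theta> j (a i)) + (\<Sum>i<e+t. y i * \<theta> j (b i)) = 0"
      "\<forall>j\<in>{2*e..<2*e+t}. (\<Sum>i<e+t. x i * \<theta> j (a i)) = 0 \<and> (\<Sum>i<e+t. y i * \<theta> j (b i)) = 0"
      unfolding pairing_det_eq_0_iff by blast
    have "(\<Sum>i<e+t. x i *s a i) \<in> A" "(\<Sum>i<e+t. y i *s b i) \<in> B"
      using a(3) b(3) A(1) B(1) by (auto intro!: vec.subspace_sum vec.subspace_scale)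
    then have "(\<Sum>i<e+t. x i *s a i) = 0 \<and> (\<Sum>i<e+t. y i *s b i) = 0"
      by (rule inj) (use xy(2,3) in \<open>simp_all add: semilinear_sum[OF \<theta>]\<close>)
    then show False
      using xy(1) independent_enumerated[OF a(1,2), of x] independent_enumerated[OF b(1,2), of y] by blast
  qed
  moreover have "pairing_det e t (\<lambda>r u. h (\<theta> r u)) a b = h (pairing_det e t \<theta> a b)"
  proof -
    have "map_mat h (Matrix.mat N N (\<lambda>(i, j). pairing_entry e t \<theta> a b i j)) =
        Matrix.mat N N (\<lambda>(i, j). pairing_entry e t (\<lambda>r u. h (\<theta> r u)) a b i j)" for N
      by (rule eq_matI) (auto simp: pairing_entry_def left_row_def right_row_def)
    then show ?thesis unfolding pairing_det_def by (metis h.hom_det)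
  qed
  moreover have "semilinear h (\<lambda>u. h (\<theta> r u))" for r
    using \<theta>[of r] by (simp add: semilinear_def h.hom_add h.hom_mult)
  ultimately show ?thesis
    by (intro exI[of _ "\<lambda>r u. h (\<theta> r u)"]) simp
qed

text \<open>The left rows vanish on the last \<open>t\<close> columns and the right rows on the
  middle \<open>t\<close>. A contributing \<open>R\<close> thus avoids the former, contains the
  latter, and has \<open>e\<close> further columns among the first \<open>2 * e\<close>.\<close>

lemma pairing_det_laplace:
  fixes \<theta> :: "nat \<Rightarrow> 'v \<Rightarrow> 'k :: comm_ring_1"
  shows "pairing_det e t \<theta> a b =
    (\<Sum>R\<in>(\<lambda>X. X \<union> {2*e..<2*e+t}) ` {X. X \<subseteq> {0..<2*e} \<and> card X = e}.
      upper_minor (e + t) (e + t) R (\<lambda>i. left_row e t \<theta> (a i)) *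
      lower_minor (e + t) (e + t) R (\<lambda>i. right_row e t \<theta> (b (i - (e + t)))))"
    (is "_ = sum ?f ?I")
proof -
  let ?k = "e + t"
  let ?Rs = "{R. R \<subseteq> {0..<?k + ?k} \<and> card R = ?k}"
  have "pairing_det e t \<theta> a b = sum ?f ?Rs"
    unfolding pairing_det_def pairing_entry_def by (rule det_rows_laplace)
  also have "\<dots> = sum ?f ?I"
  proof (rule sum.mono_neutral_right)
    show "finite ?Rs" by simp
    show "?I \<subseteq> ?Rs"
    proof (rule image_subsetI)
      fix X assume "X \<in> {X. X \<subseteq> {0..<2*e} \<and> card X = e}"
      then have X: "X \<subseteq> {0..<2*e}" "card X = e" by auto
      have "card (X \<union> {2*e..<2*e+t}) = card X + card {2*e..<2*e+t}"
        using X(1) finite_subset[OF X(1)] by (intro card_Un_disjoint) auto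
      moreover have "X \<union> {2*e..<2*e+t} \<subseteq> {0..<?k + ?k}" using X(1) by auto
      ultimately show "X \<union> {2*e..<2*e+t} \<in> ?Rs"
        using X(2) by simp
    qed
    show "\<forall>R\<in>?Rs - ?I. ?f R = 0"
    proof
      fix R assume "R \<in> ?Rs - ?I"
      then have R: "R \<subseteq> {0..<?k + ?k}" "card R = ?k" "R \<notin> ?I" by auto
      consider j where "j \<in> R" "2 * e + t \<le> j" | j where "j \<in> {2*e..<2*e+t}" "j \<notin> R"
        | "R \<subseteq> {0..<2*e+t}" "{2*e..<2*e+t} \<subseteq> R"
        by fastforce
      then show "?f R = 0"
      proof cases
        case 1
        then have "upper_minor ?k ?k R (\<lambda>i. left_row e t \<theta> (a i)) = 0"
          by (intro upper_minor_eq_0[OF R(1,2), of j]) (auto simp: left_row_def)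
        then show ?thesis by simp
      next
        case 2
        then have "lower_minor ?k ?k R (\<lambda>i. right_row e t \<theta> (b (i - ?k))) = 0"
          by (intro lower_minor_eq_0[OF R(1,2), of j]) (auto simp: right_row_def)
        then show ?thesis by simp
      next
        case 3
        define X where "X = R - {2*e..<2*e+t}"
        have "card X = e"
          using 3(2) R(2) by (simp add: X_def card_Diff_subset)
        moreover have "X \<subseteq> {0..<2*e}" "R = X \<union> {2*e..<2*e+t}"
          using 3 by (auto simp: X_def)
        ultimately show ?thesis using R(3) by blast
      qed
    qed
  qed
  finally show ?thesis .
qed

text \<open>Fueredi's theorem on skew intersection patterns. Passing to Laurent series gives an infinite
  field, over which one system of functionals can serve all indices at once.\<close>

lemma skew_bollobas_subspaces:
  fixes A B :: "nat \<Rightarrow> ('a :: field ^ 'n) set"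
  assumes A: "\<And>i. i < m \<Longrightarrow> vec.subspace (A i) \<and> vec.dim (A i) = e + t"
    and B: "\<And>i. i < m \<Longrightarrow> vec.subspace (B i) \<and> vec.dim (B i) = e + t"
    and diagonal: "\<And>i. i < m \<Longrightarrow> vec.dim (A i \<inter> B i) \<le> t"
    and above: "\<And>i j. i < j \<Longrightarrow> j < m \<Longrightarrow> t < vec.dim (A i \<inter> B j)"
  shows "m \<le> (2 * e) choose e"
proof -
  let ?k = "e + t"
  let ?h = "fls_const :: 'a \<Rightarrow> 'a fls"
  have h: "field_hom ?h"
    by unfold_locales (simp_all add: fls_plus_const fls_const_mult_const)
  have inf: "infinite (UNIV :: 'a fls set)"
  proof
    assume "finite (UNIV :: 'a fls set)"
    moreover have "inj (\<lambda>n. fls_shift n (1 :: 'a fls))"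
    proof (rule injI)
      fix i j :: int assume "fls_shift i (1 :: 'a fls) = fls_shift j 1"
      then have "fls_subdegree (fls_shift i (1 :: 'a fls)) = fls_subdegree (fls_shift j (1 :: 'a fls))" by simp
      then show "i = j" by simp
    qed
    ultimately have "finite (UNIV :: int set)"
      using finite_imageD[OF finite_subset[OF subset_UNIV]] by blast
    then show False by simp
  qed
  have basis: "\<exists>a. inj_on a {..<?k} \<and> vec.independent (a ` {..<?k}) \<and> a ` {..<?k} \<subseteq> U \<and>
      U \<subseteq> vec.span (a ` {..<?k})" if U: "vec.dim U = ?k" for U :: "('a ^ 'n) set"
  proof -
    obtain C where C: "C \<subseteq> U" "vec.independent C" "U \<subseteq> vec.span C" "card C = ?k"
      using U vec.basis_exists by metis
    then obtain a where "bij_betw a {0..<?k} C"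
      using ex_bij_betw_nat_finite[of C] vec.finiteI_independent by metis
    then show ?thesis using C by (intro exI[of _ a]) (simp add: bij_betw_def lessThan_atLeast0)
  qed
  have "\<forall>i. \<exists>a. i < m \<longrightarrow> inj_on a {..<?k} \<and> vec.independent (a ` {..<?k}) \<and> a ` {..<?k} \<subseteq> A i \<and>
      A i \<subseteq> vec.span (a ` {..<?k})"
    using basis A by blast
  from choice[OF this] obtain a where a: "\<And>i. i < m \<Longrightarrow> inj_on (a i) {..<?k}"
    "\<And>i. i < m \<Longrightarrow> vec.independent (a i ` {..<?k})" "\<And>i. i < m \<Longrightarrow> a i ` {..<?k} \<subseteq> A i"
    "\<And>i. i < m \<Longrightarrow> A i \<subseteq> vec.span (a i ` {..<?k})"
    by blast
  have "\<forall>i. \<exists>b. i < m \<longrightarrow> inj_on b {..<?k} \<and> vec.independent (b ` {..<?k}) \<and> b ` {..<?k} \<subseteq> B i \<and>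
      B i \<subseteq> vec.span (b ` {..<?k})"
    using basis B by blast
  from choice[OF this] obtain b where b: "\<And>i. i < m \<Longrightarrow> inj_on (b i) {..<?k}"
    "\<And>i. i < m \<Longrightarrow> vec.independent (b i ` {..<?k})" "\<And>i. i < m \<Longrightarrow> b i ` {..<?k} \<subseteq> B i"
    "\<And>i. i < m \<Longrightarrow> B i \<subseteq> vec.span (b i ` {..<?k})"
    by blast
  \<comment> \<open>The parameter space consists of all systems of functionals. It is closed under
    lines, and matrix entries are affine in \<open>z\<close> along them.\<close>
  define T :: "(nat \<Rightarrow> 'a ^ 'n \<Rightarrow> 'a fls) set" where "T = {\<theta>. \<forall>r. semilinear ?h (\<theta> r)}"
  define line :: "'a fls \<Rightarrow> _" where "line = (\<lambda>z \<theta> \<theta>' r (u :: 'a ^ 'n). (1 - z) * \<theta> (r :: nat) u + z * \<theta>' r u)"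
  have "\<exists>\<theta>\<in>T. \<forall>i\<in>{..<m}. pairing_det e t \<theta> (a i) (b i) \<noteq> 0"
  proof (rule common_nonvanishing_point[OF inf, where line = line])
    show "T \<noteq> {}"
      by (auto simp: T_def semilinear_def intro!: exI[of _ "\<lambda>_ _. 0"])
    show "line z \<theta> \<theta>' \<in> T" if "\<theta> \<in> T" "\<theta>' \<in> T" for z \<theta> \<theta>'
      using that by (simp add: T_def line_def semilinear_def algebra_simps)
    show "\<exists>p. \<forall>z. poly p z = pairing_det e t (line z \<theta> \<theta>') (a i) (b i)" for i \<theta> \<theta>'
    proof -
      have entry: "pairing_entry e t (line z \<theta> \<theta>') (a i) (b i) r j =
          (1 - z) * pairing_entry e t \<theta> (a i) (b i) r j + z * pairing_entry e t \<theta>' (a i) (b i) r j" for z r j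
        by (simp add: pairing_entry_def left_row_def right_row_def line_def)
      show ?thesis unfolding pairing_det_def entry by (rule det_line_poly)
    qed
    show "\<exists>\<theta>\<in>T. pairing_det e t \<theta> (a i) (b i) \<noteq> 0" if "i \<in> {..<m}" for i
      using exists_pairing_det_nonzero[OF h, of "A i" e t "B i" "a i" "b i"] that A B diagonal a b
      by (auto simp: T_def)
  qed (simp_all add: line_def)
  then obtain \<theta> where \<theta>: "\<And>r. semilinear ?h (\<theta> r)" "\<And>i. i < m \<Longrightarrow> pairing_det e t \<theta> (a i) (b i) \<noteq> 0"
    by (auto simp: T_def)
  \<comment> \<open>In each Laplace term the upper minor depends on \<open>a i\<close> only and the
    lower minor on \<open>b j\<close> only, so the number of terms bounds the rank.\<close>
  have "m \<le> card ((\<lambda>X. X \<union> {2*e..<2*e+t}) ` {X. X \<subseteq> {0..<2*e} \<and> card X = e})"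
  proof (rule triangular_rank_bound[where D = "\<lambda>i j. pairing_det e t \<theta> (a i) (b j)"])
    show "pairing_det e t \<theta> (a i) (b j) = 0" if "i < j" "j < m" for i j
      using pairing_det_eq_0[OF h \<theta>(1), of "a i" e t "A i" "b j" "B j"] that a b above by simp
  qed (use \<theta>(2) pairing_det_laplace in auto)
  also have "\<dots> \<le> card {X. X \<subseteq> {0..<2*e} \<and> card X = e}"
    by (rule card_image_le) simp
  also have "\<dots> = (2 * e) choose e" by (simp add: n_subsets)
  finally show ?thesis .
qed

section \<open>Zero forcing\<close>

text \<open>The forces are listed in the order in which they occur, and each blackens one new
  vertex. Induction from the front puts the first force at the head, while
  \<open>w \<notin> B\<close> records that later targets are still white.\<close>

lemma force_steps_chain:
  assumes "(force_step G)\<^sup>*\<^sup>* B V" and "finite V"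
  shows "\<exists>ps. length ps + card B = card V \<and> B \<subseteq> V \<and>
    (\<forall>(v, w) \<in> set ps. w \<notin> B \<and> (v, w) \<in> parcs G) \<and>
    sorted_wrt (\<lambda>(v, _) (_, w). v \<noteq> w \<and> (v, w) \<notin> parcs G) ps"
  using assms(1)
proof (induction rule: converse_rtranclp_induct)
  case base
  show ?case by (rule exI[of _ "[]"]) simp
next
  case (step B B')
  from step.hyps(1) obtain v w where vw: "v \<in> B" "neighbours G v - B = {w}" "B' = insert w B"
    by (auto elim: force_step.cases)
  from step.IH obtain ps where ps: "length ps + card B' = card V" "B' \<subseteq> V"
    "\<forall>(v, w) \<in> set ps. w \<notin> B' \<and> (v, w) \<in> parcs G"
    "sorted_wrt (\<lambda>(v, _) (_, w). v \<noteq> w \<and> (v, w) \<notin> parcs G) ps"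
    by blast
  have w: "w \<notin> B" "(v, w) \<in> parcs G"
    using vw(2) by (auto simp: neighbours_def)
  have "finite B"
    using ps(2) vw(3) assms(2) finite_subset by auto
  then have "length ((v, w) # ps) + card B = card V"
    using ps(1) vw(3) w(1) by simp
  \<comment> \<open>A later target \<open>w'\<close> is white before and after this force: it
    differs from the black \<open>v\<close>, and it is no neighbour of \<open>v\<close>, whose only
    white neighbour is \<open>w\<close>.\<close>
  moreover have "v \<noteq> w' \<and> (v, w') \<notin> parcs G" if "(v', w') \<in> set ps" for v' w'
  proof -
    have "w' \<notin> B'" using ps(3) that by auto
    then show ?thesis using vw by (auto simp: neighbours_def)
  qed
  ultimately show ?case
    using ps w vw(3) by (intro exI[of _ "(v, w) # ps"]) auto
qed

theorem theorem4p8: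
  fixes q n k t :: nat and S :: "nat set"
    and G :: "('a :: {field, finite} ^ 'n) set pair_pre_digraph"
  assumes "primepow q" and "CARD('a) = q"
    and "CARD('n) = n"
    and "n > 0" and "k > 0" and "n \<ge> 2 * k + 1"
    and "t \<in> {0..k - 1}" and "S = {0..t}"
    and "G = gen_grassmann_graph S k"
  shows "real (zero_forcing_number G)
           \<ge> gaussian_binomial q n k - real ((2 * k - 2 * t) choose (k - t))"
proof -
  have verts: "pverts G = {U. vec.subspace U \<and> vec.dim U = k}"
    and arcs: "parcs G = {(U, W). vec.subspace U \<and> vec.dim U = k \<and> vec.subspace W \<and>
      vec.dim W = k \<and> U \<noteq> W \<and> vec.dim (U \<inter> W) \<le> t}"
    using assms(8,9) by (simp_all add: gen_grassmann_graph_def)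
  have "zero_forcing_number G \<in> card ` {B. zero_forcing_set G B}"
    unfolding zero_forcing_number_def
    using zero_forcing_set_pverts[of G] finite_zero_forcing_sets[of G]
    by (intro Min_in) auto
  then obtain B where B: "zero_forcing_set G B" "zero_forcing_number G = card B" by auto
  obtain ps where ps: "length ps + card B = card (pverts G)"
    "\<forall>(v, w) \<in> set ps. w \<notin> B \<and> (v, w) \<in> parcs G"
    "sorted_wrt (\<lambda>(v, _) (_, w). v \<noteq> w \<and> (v, w) \<notin> parcs G) ps"
    using force_steps_chain[of G B "pverts G"] B(1) by (auto simp: zero_forcing_set_def)
  have arc: "(fst (ps ! i), snd (ps ! i)) \<in> parcs G" if "i < length ps" for i
    using ps(2) nth_mem[OF that] by (auto simp: case_prod_unfold)
  have non_arc: "fst (ps ! i) \<noteq> snd (ps ! j) \<and> (fst (ps ! i), snd (ps ! j)) \<notin> parcs G"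
    if "i < j" "j < length ps" for i j
    using sorted_wrt_nth_less[OF ps(3) that] by (simp add: case_prod_unfold)
  \<comment> \<open>From \<open>k > 0\<close> and \<open>t \<le> k - 1\<close> follows
    \<open>t < k\<close>, so the subtraction is exact.\<close>
  have kt: "k - t + t = k" using assms(5,7) by simp
  have "length ps \<le> (2 * (k - t)) choose (k - t)"
  proof (rule skew_bollobas_subspaces[where A = "\<lambda>i. fst (ps ! i)" and B = "\<lambda>i. snd (ps ! i)" and t = t])
    fix i assume i: "i < length ps"
    show "vec.subspace (fst (ps ! i)) \<and> vec.dim (fst (ps ! i)) = k - t + t"
      and "vec.subspace (snd (ps ! i)) \<and> vec.dim (snd (ps ! i)) = k - t + t"
      and "vec.dim (fst (ps ! i) \<inter> snd (ps ! i)) \<le> t"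
      using arc[OF i] unfolding kt arcs by (simp_all add: case_prod_unfold)
  next
    fix i j assume ij: "i < j" "j < length ps"
    then have "i < length ps" by simp
    \<comment> \<open>Both are vertices, each being an end of its own forcing arc; distinct and not
      adjacent, they can only meet in dimension above \<open>t\<close>.\<close>
    then show "t < vec.dim (fst (ps ! i) \<inter> snd (ps ! j))"
      using arc[of i] arc[OF ij(2)] non_arc[OF ij] unfolding arcs by (auto simp: case_prod_unfold)
  qed
  moreover have "real (card (pverts G)) = gaussian_binomial q n k"
    unfolding verts using card_subspaces_of_dim[where 'a = 'a and 'n = 'n and k = k] assms(2,3,6) by simp
  ultimately show ?thesis
    using ps(1) B(2) by (simp add: diff_mult_distrib2)
qed

end
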